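(* Let $\mathbf{P}=[p_{i,j}]\in\mathbb{R}^{N\times N}$ be a Markov transition matrix with $p_{i,i}\ne 1$ for all $i$, and column sums $\mathscr{C}_j=\sum_{\ell=1}^N p_{\ell,j}$. Then, for any $q\in[0,1)$, $$p_{j,j}+\frac{|\lambda_j-p_{j,j}|^{1/(1-q)}}{(1-p_{j,j})^{q/(1-q)}}\le\mathscr{C}_j,$$ where $\lambda_j$ is the $j$-th eigenvalue of $\mathbf{P}$ such that $$|\lambda_j-p_{j,j}|\le(1-p_{j,j})^q(\mathscr{C}_j-p_{j,j})^{1-q}.$$
   Context: A Markov transition matrix is a matrix with nonnegative entries all of whose row sums $\sum_{\ell=1}^N p_{i,\ell}$ equal $1$. Here $\lambda_j$ denotes an eigenvalue of $\mathbf{P}$ associated with the index $j$ by the displayed condition. *)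

theory Defs
  imports Complex_Main "Jordan_Normal_Form.Char_Poly"
begin

definition markov_matrix :: "nat \<Rightarrow> real mat \<Rightarrow> bool" where
  "markov_matrix N P \<longleftrightarrow> P \<in> carrier_mat N N
     \<and> (\<forall>i<N. \<forall>j<N. 0 \<le> P $$ (i, j))
     \<and> (\<forall>i<N. (\<Sum>l<N. P $$ (i, l)) = 1)"

definition col_sum :: "real mat \<Rightarrow> nat \<Rightarrow> real" where
  "col_sum P j = (\<Sum>l<dim_row P. P $$ (l, j))"

end

theory Submission
  imports Defs
begin

text \<open>
  The bound on the distance from the eigenvalue to the diagonal entry is a weighted geometric
  mean of the off-diagonal row sum \<open>a = 1 - P $$ (j, j)\<close> and the off-diagonal column
  sum \<open>c = col_sum P j - P $$ (j, j)\<close>. The conclusion is this same bound solved for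
  \<open>c\<close>: raising it to the power \<open>1 / (1 - q)\<close> makes \<open>c\<close> appear linearly, and the
  remaining power of \<open>a\<close> can be divided out because \<open>a > 0\<close>. Both \<open>a\<close> and \<open>c\<close> are sums of
  nonnegative entries, and \<open>a\<close> does not vanish since no diagonal entry equals 1.
\<close>

text \<open>The exponents \<open>1 / (1 - q)\<close> and \<open>q / (1 - q)\<close> are forced: the first is the inverse of
  the exponent \<open>1 - q\<close> on \<open>c\<close>, and the second is what it makes of the exponent \<open>q\<close> on \<open>a\<close>.\<close>

lemma weighted_geometric_mean_bound_solve:
  fixes a c d q :: real
  assumes a: "0 < a" and c: "0 \<le> c" and d: "0 \<le> d" and q: "q < 1"
    and bound: "d \<le> a powr q * c powr (1 - q)"
  shows "d powr (1 / (1 - q)) / a powr (q / (1 - q)) \<le> c"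
proof -
  have "d powr (1 / (1 - q)) \<le> (a powr q * c powr (1 - q)) powr (1 / (1 - q))"
    using d q bound by (intro powr_mono2) auto
  also have "\<dots> = a powr (q / (1 - q)) * c"
    using c q by (simp add: powr_mult powr_powr)
  finally show ?thesis
    using a by (simp add: divide_le_eq mult.commute)
qed

lemma markov_matrix_diag_le_1:
  assumes "markov_matrix N P" and "j < N"
  shows "P $$ (j, j) \<le> 1"
proof -
  have "P $$ (j, j) \<le> (\<Sum>l<N. P $$ (j, l))"
    using assms by (intro member_le_sum) (auto simp: markov_matrix_def)
  also have "\<dots> = 1"
    using assms by (simp add: markov_matrix_def)
  finally show ?thesis .
qed

lemma markov_matrix_diag_le_col_sum:
  assumes "markov_matrix N P" and "j < N"
  shows "P $$ (j, j) \<le> col_sum P j"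
  unfolding col_sum_def
  using assms by (intro member_le_sum) (auto simp: markov_matrix_def)

theorem lemma5:
  fixes P :: "real mat" and N j :: nat and q :: real and lam :: complex
  assumes "markov_matrix N P"
    and "\<forall>i<N. P $$ (i, i) \<noteq> 1"
    and "0 \<le> q" and "q < 1"
    and "j < N"
    and "eigenvalue (map_mat complex_of_real P) lam"
    and "cmod (lam - complex_of_real (P $$ (j, j)))
           \<le> (1 - P $$ (j, j)) powr q * (col_sum P j - P $$ (j, j)) powr (1 - q)"
  shows "P $$ (j, j)
           + cmod (lam - complex_of_real (P $$ (j, j))) powr (1 / (1 - q))
             / (1 - P $$ (j, j)) powr (q / (1 - q))
         \<le> col_sum P j"
proof -
  have "0 < 1 - P $$ (j, j)"
    using markov_matrix_diag_le_1[OF assms(1,5)] assms(2,5) by force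
  moreover have "0 \<le> col_sum P j - P $$ (j, j)"
    using markov_matrix_diag_le_col_sum[OF assms(1,5)] by simp
  ultimately have "cmod (lam - complex_of_real (P $$ (j, j))) powr (1 / (1 - q))
      / (1 - P $$ (j, j)) powr (q / (1 - q)) \<le> col_sum P j - P $$ (j, j)"
    using assms(4,7) by (intro weighted_geometric_mean_bound_solve) auto
  then show ?thesis
    by simp
qed

end
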